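(* For a natural number $n$, $$\varphi(n)=\frac{4}{2\,\tau(n)+n^2-5n+2}\,\sum_{j=1}^{n-1}\ \sum_{\substack{k=1\\ \gcd(k,n)=1}}^{n}\left\lfloor\frac{j(k-1)}{n}\right\rfloor .$$
   Context: $\varphi(n)$ is Euler's totient function, defined as $\varphi(n)=\sum_{\substack{k=1\\ \gcd(k,n)=1}}^{n-1}1$, where $\gcd(k,n)$ denotes the greatest common divisor of $k$ and $n$. $\tau(n)=\sum_{d\mid n}1$ is the number of divisors of the natural number $n$. $\lfloor x\rfloor$ denotes the integer part (floor) of $x$.
   Formalization: The formula is proved for natural numbers n with 2τ(n)+n²−5n+2 ≠ 0, i.e. n ≥ 4; for n = 1, 2, 3 this denominator is 0 and the right-hand side is undefined. *)

theory Defs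
  imports Complex_Main "HOL-Number_Theory.Totient"
begin

text \<open>
  Euler's function is the library's \<^const>\<open>totient\<close>.  The sum over \<open>1 \<le> k \<le> n - 1\<close> that is
  often taken as its definition agrees with it for \<open>n \<ge> 2\<close>; at \<open>n = 1\<close> that sum is empty,
  whereas \<open>totient 1 = 1\<close>.
\<close>

lemma totient_eq_sum:
  assumes "n \<ge> 2"
  shows "totient n = (\<Sum>k | k \<in> {1..n-1} \<and> gcd k n = 1. 1)"
proof -
  have "k \<noteq> n" if "coprime k n" for k
    using that assms by auto
  then have "totatives n = {k. k \<in> {1..n-1} \<and> gcd k n = 1}"
    using assms by (fastforce simp: totatives_def coprime_iff_gcd_eq_1)
  then show ?thesis
    by (simp add: totient_def)
qed

definition tau :: "nat \<Rightarrow> nat" where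
  "tau n = (\<Sum>d | d dvd n. 1)"

end

(* Reversing j in the inner sum evaluates it to ((k - 2) (n - 1) + gcd (k - 1) n - 1) / 2.
   Summing over the units k modulo n, the linear part follows from the symmetry k -> n - k, and
   the gcd part is Menon's identity: the sum of gcd (k - 1) n over the units equals
   totient n * tau n.  The latter comes from expanding the gcd as a sum of totients over its
   divisors d and counting the units congruent to 1 modulo d, of which there are
   totient n / totient d because reduction modulo d is a surjective homomorphism. *)
theory Submission imports Defs begin

section \<open>Units modulo n in a residue class modulo a divisor of n\<close>

text \<open>For \<open>d\<close> dividing \<open>n\<close> this gives surjectivity of reduction from
  the units modulo \<open>n\<close> to the units modulo \<open>d\<close>.\<close>

lemma coprime_lift:
  fixes a d n :: nat
  assumes "n > 0" "coprime a d"
  obtains A where "coprime A n" "[A = a] (mod d)"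
proof
  \<comment> \<open>The lift is \<open>a + d * t\<close>. A prime of \<open>n\<close> dividing
    \<open>a\<close> divides neither \<open>d\<close> nor \<open>t\<close>, and a prime of
    \<open>n\<close> not dividing \<open>a\<close> divides \<open>t\<close>; so each one divides
    exactly one of the two summands, hence not the sum.\<close>
  define t where "t = \<Prod>{p. prime p \<and> p dvd n \<and> \<not> p dvd a}"
  have fin: "finite {p. prime p \<and> p dvd n \<and> \<not> p dvd a}"
    using assms(1) by (auto intro: finite_subset[OF _ finite_divisors_nat])
  show "coprime (a + d * t) n"
  proof (rule ccontr)
    assume "\<not> coprime (a + d * t) n"
    then obtain p where p: "prime p" "p dvd a + d * t" "p dvd n"
      by (metis coprime_iff_gcd_eq_1 gcd_greatest_iff prime_factor_nat)
    show False
    proof (cases "p dvd a")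
      case True
      then have "p dvd d * t"
        using p(2) dvd_add_right_iff by blast
      moreover have "\<not> p dvd d"
        using True assms(2) p(1) by (metis coprime_common_divisor not_prime_unit)
      ultimately have "p dvd t"
        using p(1) prime_dvd_mult_iff by blast
      then obtain q where "prime q" "\<not> q dvd a" "p dvd q"
        using p(1) fin unfolding t_def by (auto simp: prime_dvd_prod_iff)
      then show False
        using True p(1) primes_dvd_imp_eq by blast
    next
      case False
      then have "p dvd t"
        unfolding t_def using p fin by (intro dvd_prodI) auto
      then show False
        using False p(2) by (simp add: dvd_add_left_iff)
    qed
  qed
  show "[a + d * t = a] (mod d)"
    by (simp add: cong_def)
qed

lemma bij_betw_totatives_mult_mod:
  fixes A n :: nat
  assumes "n > 1" "coprime A n"
  shows "bij_betw (\<lambda>k. A * k mod n) (totatives n) (totatives n)"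
proof -
  let ?f = "\<lambda>k. A * k mod n"
  have inj: "inj_on ?f (totatives n)"
  proof (rule inj_onI)
    fix x y
    assume xy: "x \<in> totatives n" "y \<in> totatives n" "?f x = ?f y"
    then have "[x = y] (mod n)"
      using assms(2) cong_mult_lcancel_nat by (auto simp: cong_def)
    moreover have "x < n" "y < n"
      using xy assms(1) totatives_less by auto
    ultimately show "x = y"
      using cong_less_modulus_unique_nat by blast
  qed
  have "?f ` totatives n \<subseteq> totatives n"
  proof
    fix y
    assume "y \<in> ?f ` totatives n"
    then obtain x where "coprime x n" "y = A * x mod n"
      by (auto simp: in_totatives_iff)
    then have "coprime y n"
      using assms by (simp add: coprime_commute)
    moreover have "y \<noteq> 0"
      using \<open>coprime y n\<close> assms(1) by (intro notI) simp
    ultimately show "y \<in> totatives n"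
      using assms(1) \<open>y = _\<close> by (simp add: in_totatives_iff less_imp_le)
  qed
  with inj show ?thesis
    by (simp add: bij_betw_def endo_inj_surj)
qed

text \<open>Multiplication by a lift \<open>A\<close> of \<open>a\<close> permutes the units modulo
  \<open>n\<close> and carries the class of 1 modulo \<open>d\<close> onto the class of
  \<open>a\<close>.\<close>

lemma card_totatives_cong:
  fixes a d n :: nat
  assumes "n > 1" "coprime a d" "d dvd n"
  shows "card {k \<in> totatives n. [k = a] (mod d)} = card {k \<in> totatives n. [k = 1] (mod d)}"
proof -
  obtain A where A: "coprime A n" "[A = a] (mod d)"
    using coprime_lift[of n a d] assms by auto
  let ?f = "\<lambda>k. A * k mod n"
  \<comment> \<open>Reducing modulo \<open>n\<close> keeps the residue modulo \<open>d\<close>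
    because \<open>d\<close> divides \<open>n\<close>; then \<open>a\<close> cancels, being a unit
    modulo \<open>d\<close>.\<close>
  have iff: "[?f k = a] (mod d) \<longleftrightarrow> [k = 1] (mod d)" for k
  proof -
    have "[?f k = a * k] (mod d)"
      using A(2) assms(3) by (metis cong_def cong_scalar_right mod_mod_cancel)
    then have "[?f k = a] (mod d) \<longleftrightarrow> [a * k = a * 1] (mod d)"
      by (simp add: cong_def)
    also have "\<dots> \<longleftrightarrow> [k = 1] (mod d)"
      using assms(2) cong_mult_lcancel_nat by blast
    finally show ?thesis .
  qed
  have bij: "bij_betw ?f (totatives n) (totatives n)"
    using bij_betw_totatives_mult_mod assms(1) A(1) .
  have "?f ` {k \<in> totatives n. [k = 1] (mod d)} = {k \<in> totatives n. [k = a] (mod d)}"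
  proof -
    have "{k \<in> totatives n. [k = a] (mod d)} = {y \<in> ?f ` totatives n. [y = a] (mod d)}"
      using bij_betw_imp_surj_on[OF bij] by simp
    also have "\<dots> = ?f ` {k \<in> totatives n. [?f k = a] (mod d)}"
      by blast
    finally show ?thesis
      unfolding iff by simp
  qed
  moreover have "inj_on ?f {k \<in> totatives n. [k = 1] (mod d)}"
    using bij by (auto simp: bij_betw_def intro: inj_on_subset)
  ultimately show ?thesis
    using card_image[of ?f "{k \<in> totatives n. [k = 1] (mod d)}"] by argo
qed

text \<open>The units modulo \<open>n\<close> split into classes indexed by the units modulo
  \<open>d\<close>, and all these classes are as large as that of 1.\<close>

lemma totient_mult_card_totatives_cong_1:
  fixes d n :: nat
  assumes "n > 0" "d dvd n"
  shows "totient d * card {k \<in> totatives n. [k = 1] (mod d)} = totient n"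
\<comment> \<open>For \<open>d = 1\<close> the representative \<open>k mod d\<close> used below
  would be 0, whereas \<open>totatives 1\<close> is {1}.\<close>
proof (cases "d = 1")
  case True
  then show ?thesis
    by (simp add: totient_def)
next
  case False
  then have d: "d > 1" and n: "n > 1"
    using assms by (auto intro: Nat.gr0I dest: dvd_imp_le simp: Suc_lessI nat_neq_iff)
  have "totatives n = (\<Union>a\<in>totatives d. {k \<in> totatives n. [k = a] (mod d)})"
  proof (intro equalityI subsetI)
    fix k
    assume k: "k \<in> totatives n"
    have "coprime (k mod d) d"
      using k assms(2) d coprime_divisors[of k k d n]
      by (auto simp: in_totatives_iff coprime_commute)
    then have "k mod d \<in> totatives d"
      using d by (cases "k mod d = 0") (auto simp: in_totatives_iff less_imp_le)
    then show "k \<in> (\<Union>a\<in>totatives d. {k \<in> totatives n. [k = a] (mod d)})"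
      using k by (auto simp: cong_def intro!: bexI[of _ "k mod d"])
  qed auto
  then have "totient n = card (\<Union>a\<in>totatives d. {k \<in> totatives n. [k = a] (mod d)})"
    by (simp add: totient_def)
  also have "\<dots> = (\<Sum>a\<in>totatives d. card {k \<in> totatives n. [k = a] (mod d)})"
  proof (rule card_UN_disjoint)
    show "\<forall>a\<in>totatives d. \<forall>b\<in>totatives d. a \<noteq> b \<longrightarrow>
        {k \<in> totatives n. [k = a] (mod d)} \<inter> {k \<in> totatives n. [k = b] (mod d)} = {}"
      using d by (auto simp: cong_def dest!: totatives_less)
  qed auto
  also have "\<dots> = (\<Sum>a\<in>totatives d. card {k \<in> totatives n. [k = 1] (mod d)})"
    by (intro sum.cong refl card_totatives_cong[OF n _ assms(2)]) (simp add: in_totatives_iff)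
  finally show ?thesis
    by (simp add: totient_def)
qed

section \<open>Sums over the units: Menon's identity and the sum of the units\<close>

lemma Menon_identity:
  fixes n :: nat
  assumes "n > 0"
  shows "(\<Sum>k\<in>totatives n. gcd (k - 1) n) = totient n * tau n"
proof -
  have "(\<Sum>k\<in>totatives n. gcd (k - 1) n) =
      (\<Sum>k\<in>totatives n. \<Sum>d | d dvd n. if [k = 1] (mod d) then totient d else 0)"
  proof (rule sum.cong)
    fix k
    assume "k \<in> totatives n"
    \<comment> \<open>Totatives are at least 1, so the natural subtraction \<open>k - 1\<close> is
      exact. For \<open>k = 1\<close> the gcd is \<open>n\<close>, and every divisor of
      \<open>n\<close> contributes.\<close>
    then have "[k = 1] (mod d) \<longleftrightarrow> d dvd k - 1" for d
      using cong_altdef_nat[of 1 k d] by (auto simp: in_totatives_iff)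
    then have "{d. d dvd gcd (k - 1) n} = {d \<in> {d. d dvd n}. [k = 1] (mod d)}"
      by auto
    moreover have "finite {d. d dvd n}"
      using assms by simp
    ultimately show "gcd (k - 1) n = (\<Sum>d | d dvd n. if [k = 1] (mod d) then totient d else 0)"
      using totient_divisor_sum[of "gcd (k - 1) n"]
        sum.inter_filter[of "{d. d dvd n}" totient "\<lambda>d. [k = 1] (mod d)"] by argo
  qed simp
  also have "\<dots> = (\<Sum>d | d dvd n. \<Sum>k\<in>totatives n. if [k = 1] (mod d) then totient d else 0)"
    by (rule sum.swap)
  also have "\<dots> = (\<Sum>d | d dvd n. totient d * card {k \<in> totatives n. [k = 1] (mod d)})"
    by (simp add: sum.inter_filter[OF finite_totatives, symmetric] mult.commute)
  also have "\<dots> = (\<Sum>d | d dvd n. totient n)"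
    using totient_mult_card_totatives_cong_1[OF assms] by (intro sum.cong) auto
  finally show ?thesis
    by (simp add: tau_def)
qed

lemma two_mult_sum_totatives:
  fixes n :: nat
  assumes "n > 1"
  shows "2 * (\<Sum>k\<in>totatives n. k) = n * totient n"
proof -
  have "(\<Sum>k\<in>totatives n. k) = (\<Sum>k\<in>totatives n. n - k)"
  proof (rule sum.reindex_bij_witness[where i = "\<lambda>k. n - k" and j = "\<lambda>k. n - k"])
    fix k
    assume k: "k \<in> totatives n"
    \<comment> \<open>Since \<open>n > 1\<close>, the value \<open>k = n\<close> does not occur, so
      \<open>n - k\<close> is positive and the reflection maps \<open>totatives n\<close> to
      itself.\<close>
    then have "k < n"
      using assms totatives_less by auto
    then show "n - (n - k) = k" "n - (n - k) = k" "n - (n - k) = k"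
      by auto
    have "coprime (n - k) n"
      using k \<open>k < n\<close>
      by (metis coprime_commute coprime_diff_one_left_nat gcd_diff2_nat coprime_iff_gcd_eq_1
          in_totatives_iff less_imp_le)
    then show "n - k \<in> totatives n" "n - k \<in> totatives n"
      using \<open>k < n\<close> by (auto simp: in_totatives_iff)
  qed
  then have "2 * (\<Sum>k\<in>totatives n. k) = (\<Sum>k\<in>totatives n. k + (n - k))"
    by (simp add: sum.distrib)
  also have "\<dots> = (\<Sum>k\<in>totatives n. n)"
    by (intro sum.cong) (auto simp: in_totatives_iff)
  finally show ?thesis
    by (simp add: totient_def mult.commute)
qed

section \<open>Evaluation of the inner floor sum\<close>

text \<open>Cancelling \<open>g = gcd m n\<close> turns the condition into divisibility of
  \<open>j\<close> by \<open>n' = n / g\<close>, and exactly \<open>g\<close> multiples of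
  \<open>n'\<close> lie in \<open>{1..n}\<close>.\<close>

lemma card_dvd_mult:
  fixes m n :: nat
  assumes "n > 0"
  shows "card {j \<in> {1..n}. n dvd j * m} = gcd m n"
proof -
  define g where "g = gcd m n"
  have g: "g > 0"
    using assms by (simp add: g_def)
  obtain m' n' where mn: "m = m' * g" "n = n' * g" "coprime m' n'"
    using gcd_coprime_exists[of m n] g unfolding g_def by blast
  have n': "n' > 0"
    using assms mn by auto
  have "{j \<in> {1..n}. n dvd j * m} = (\<lambda>i. i * n') ` {1..g}"
  proof (intro equalityI subsetI)
    fix j
    assume "j \<in> {j \<in> {1..n}. n dvd j * m}"
    then have j: "1 \<le> j" "j \<le> n' * g" "n' * g dvd (j * m') * g"
      using mn by (auto simp: mult.assoc)
    then have "n' dvd j"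
      using g mn(3) by (simp add: coprime_commute coprime_dvd_mult_left_iff)
    then obtain i where "j = i * n'"
      by (metis dvd_def mult.commute)
    then show "j \<in> (\<lambda>i. i * n') ` {1..g}"
      using j n' by (auto simp: mult.commute Suc_le_eq)
  next
    fix j
    assume "j \<in> (\<lambda>i. i * n') ` {1..g}"
    then show "j \<in> {j \<in> {1..n}. n dvd j * m}"
      using n' mn by (auto simp: Suc_le_eq mult.commute)
  qed
  then show ?thesis
    using n' by (simp add: card_image inj_on_def g_def)
qed

text \<open>Pairing \<open>j\<close> with \<open>n - j\<close> gives two fractions with sum
  \<open>m\<close>. Their floors add up to \<open>m\<close> if \<open>n\<close> divides
  \<open>j * m\<close> and to \<open>m - 1\<close> otherwise, so the gcd enters by counting the
  exceptional \<open>j\<close>.\<close>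

lemma sum_mult_div:
  fixes m n :: nat
  assumes "n > 0"
  shows "2 * (\<Sum>j = 1..n-1. int (j * m div n)) = (int m - 1) * (int n - 1) + int (gcd m n) - 1"
proof -
  have pair: "int (j * m div n) + int ((n - j) * m div n) =
      int m - 1 + (if n dvd j * m then 1 else 0)" if "j \<in> {1..n-1}" for j
  proof -
    have "int ((n - j) * m) = - int (j * m) + int n * int m"
    proof -
      have "int (n - j) = int n - int j"
        using that by auto
      then show ?thesis
        unfolding of_nat_mult by (simp add: algebra_simps)
    qed
    then have "int ((n - j) * m div n) = (- int (j * m) + int n * int m) div int n"
      by (simp only: zdiv_int)
    also have "\<dots> = (- int (j * m)) div int n + int m"
      using assms div_mult_self2[of "int n" "- int (j * m)" "int m"] by linarith
    \<comment> \<open>The floor of -x is minus the floor of x, less 1 unless x is an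
      integer.\<close>
    also have "(- int (j * m)) div int n =
        - int (j * m div n) - (if n dvd j * m then 0 else 1)"
      using assms
      by (simp add: zdiv_zminus1_eq_if zdiv_int zmod_int[symmetric] dvd_eq_mod_eq_0
          del: of_nat_mult)
    finally show ?thesis
      by simp
  qed
  have "(\<Sum>j = 1..n-1. int (j * m div n)) = (\<Sum>j = 1..n-1. int ((n - j) * m div n))"
    by (rule sum.reindex_bij_witness[where i = "\<lambda>j. n - j" and j = "\<lambda>j. n - j"]) auto
  then have "2 * (\<Sum>j = 1..n-1. int (j * m div n)) =
      (\<Sum>j = 1..n-1. int (j * m div n) + int ((n - j) * m div n))"
    by (simp add: sum.distrib)
  also have "\<dots> = (\<Sum>j = 1..n-1. int m - 1 + (if n dvd j * m then 1 else 0))"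
    using pair by (intro sum.cong) auto
  also have "\<dots> = (int n - 1) * (int m - 1) + int (card {j \<in> {1..n-1}. n dvd j * m})"
    using assms by (simp add: sum.distrib sum.inter_filter[symmetric] of_nat_diff)
  \<comment> \<open>The sum stops at \<open>n - 1\<close>, while \<open>card_dvd_mult\<close> counts
    up to \<open>n\<close>; the index \<open>j = n\<close> always qualifies, which explains the
    final -1.\<close>
  also have "{j \<in> {1..n}. n dvd j * m} = insert n {j \<in> {1..n-1}. n dvd j * m}"
    using assms by auto
  then have "int (card {j \<in> {1..n-1}. n dvd j * m}) = int (gcd m n) - 1"
    using card_dvd_mult[OF assms, of m] assms by (simp add: card_insert_if)
  finally show ?thesis
    by (simp add: algebra_simps)
qed

(* Division by zero is 0 in HOL, so the condition under which the displayed fraction is defined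
   is made explicit. *)
theorem mainTheorem3:
  fixes n :: nat
  assumes "n \<ge> 1"
    and "2 * real (tau n) + (real n)^2 - 5 * real n + 2 \<noteq> 0"
  shows "real (totient n) =
    4 / (2 * real (tau n) + (real n)^2 - 5 * real n + 2) *
    real_of_int (\<Sum>j = 1..n-1. \<Sum>k | k \<in> {1..n} \<and> gcd k n = 1.
      \<lfloor>real j * (real k - 1) / real n\<rfloor>)"
proof -
  \<comment> \<open>At \<open>n = 1\<close> the denominator is 2 + 1 - 5 + 2 = 0.\<close>
  have "n \<noteq> 1"
    using assms(2) by (auto simp: tau_def)
  then have n: "n > 1"
    using assms(1) by simp
  define S where "S = (\<Sum>j = 1..n-1. \<Sum>k | k \<in> {1..n} \<and> gcd k n = 1.
      \<lfloor>real j * (real k - 1) / real n\<rfloor>)"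
  have tot: "{k. k \<in> {1..n} \<and> gcd k n = 1} = totatives n"
    by (auto simp: in_totatives_iff coprime_iff_gcd_eq_1)
  have floor: "\<lfloor>real j * (real k - 1) / real n\<rfloor> = int (j * (k - 1) div n)"
    if "k \<in> totatives n" for j k
  proof -
    have "real j * (real k - 1) = real (j * (k - 1))"
      using that by (simp add: in_totatives_iff of_nat_diff)
    then show ?thesis
      by (metis floor_divide_of_nat_eq)
  qed
  have "S = (\<Sum>k\<in>totatives n. \<Sum>j = 1..n-1. int (j * (k - 1) div n))"
    unfolding S_def tot by (subst sum.swap) (simp add: floor)
  then have "2 * S = (\<Sum>k\<in>totatives n. 2 * (\<Sum>j = 1..n-1. int (j * (k - 1) div n)))"
    by (simp add: sum_distrib_left)
  \<comment> \<open>The constant collects (k - 2) (n - 1) - 1 = (n - 1) k - (2 n - 1).\<close>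
  also have "\<dots> = (\<Sum>k\<in>totatives n. (int n - 1) * int k + int (gcd (k - 1) n) - (2 * int n - 1))"
  proof (rule sum.cong)
    fix k
    assume "k \<in> totatives n"
    then have "int (k - 1) = int k - 1"
      by (simp add: in_totatives_iff of_nat_diff)
    then show "2 * (\<Sum>j = 1..n-1. int (j * (k - 1) div n)) =
        (int n - 1) * int k + int (gcd (k - 1) n) - (2 * int n - 1)"
      using sum_mult_div[of n "k - 1"] n by (simp add: algebra_simps)
  qed simp
  also have "\<dots> = (int n - 1) * int (\<Sum>k\<in>totatives n. k) +
      int (\<Sum>k\<in>totatives n. gcd (k - 1) n) - int (totient n) * (2 * int n - 1)"
    by (simp add: sum.distrib sum_subtractf sum_distrib_left totient_def)
  also have "(\<Sum>k\<in>totatives n. gcd (k - 1) n) = totient n * tau n"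
    using Menon_identity n by simp
  \<comment> \<open>Doubling once more avoids halves: one factor 2 comes from pairing
    \<open>j\<close> with \<open>n - j\<close>, the other from pairing \<open>k\<close> with
    \<open>n - k\<close>.\<close>
  finally have "4 * S = (int n - 1) * int (2 * (\<Sum>k\<in>totatives n. k)) +
      2 * int (totient n * tau n) - 2 * int (totient n) * (2 * int n - 1)"
    by (simp add: algebra_simps)
  also have "\<dots> = int (totient n) * (2 * int (tau n) + (int n)^2 - 5 * int n + 2)"
    unfolding two_mult_sum_totatives[OF n] by (simp add: algebra_simps power2_eq_square)
  finally have "real_of_int (4 * S) =
      real_of_int (int (totient n) * (2 * int (tau n) + (int n)^2 - 5 * int n + 2))"
    by (rule arg_cong)
  then have "4 * real_of_int S =
      real (totient n) * (2 * real (tau n) + (real n)^2 - 5 * real n + 2)"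
    by simp
  then show ?thesis
    unfolding S_def[symmetric] using assms(2) by (simp add: field_simps)
qed

end
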